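(* Let $\Phi:(S,\cdot)\to(T,\cdot)$ be a semigroup homomorphism such that $\Phi(S)$ is piecewise syndetic in $T$. If $A\subseteq S$ is quasi-central in $S$, then $\Phi(A)$ is quasi-central in $T$.
   Context: For a semigroup $(X,\cdot)$, $B\subseteq X$ and $x\in X$, let $x^{-1}B=\{y\in X: x\cdot y\in B\}$; $\mathcal P_f(X)$ denotes the set of finite nonempty subsets of $X$. A set $B\subseteq X$ is piecewise syndetic in $X$ if there exists $G\in\mathcal P_f(X)$ such that for every $F\in\mathcal P_f(X)$ there exists $x\in X$ with $F\cdot x\subseteq\bigcup_{t\in G}t^{-1}B$. A family $\langle C_F\rangle_{F\in\mathcal I}$ is downward directed if $(\mathcal I,\geq)$ is a directed set and $F\geq G$ implies $C_F\subseteq C_G$. A set $A\subseteq X$ is quasi-central in $X$ if there is a downward directed family $\langle C_F\rangle_{F\in\mathcal I}$ of subsets of $A$ such that (1) for each $F\in\mathcal I$ and each $x\in C_F$ there is $G\in\mathcal I$ with $C_G\subseteq x^{-1}C_F$, and (2) each $C_F$ is piecewise syndetic in $X$. *)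

theory Defs
  imports Main
begin

definition left_quotient :: "'a::semigroup_mult \<Rightarrow> 'a set \<Rightarrow> 'a set" where
  "left_quotient x B = {y. x * y \<in> B}"

definition piecewise_syndetic :: "'a::semigroup_mult set \<Rightarrow> bool" where
  "piecewise_syndetic B \<longleftrightarrow>
     (\<exists>G. finite G \<and> G \<noteq> {} \<and>
       (\<forall>F. finite F \<and> F \<noteq> {} \<longrightarrow>
         (\<exists>x. (\<lambda>f. f * x) ` F \<subseteq> (\<Union>t\<in>G. left_quotient t B))))"

definition semigroup_hom :: "('a::semigroup_mult \<Rightarrow> 'b::semigroup_mult) \<Rightarrow> bool" where
  "semigroup_hom \<Phi> \<longleftrightarrow> (\<forall>x y. \<Phi> (x * y) = \<Phi> x * \<Phi> y)"

definition directed_set :: "'i set \<Rightarrow> ('i \<Rightarrow> 'i \<Rightarrow> bool) \<Rightarrow> bool" where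
  "directed_set I ge \<longleftrightarrow>
     I \<noteq> {} \<and> reflp_on I ge \<and> transp_on I ge \<and>
     (\<forall>F\<in>I. \<forall>G\<in>I. \<exists>H\<in>I. ge H F \<and> ge H G)"

definition downward_directed ::
  "'i set \<Rightarrow> ('i \<Rightarrow> 'i \<Rightarrow> bool) \<Rightarrow> ('i \<Rightarrow> 'a set) \<Rightarrow> bool" where
  "downward_directed I ge C \<longleftrightarrow>
     directed_set I ge \<and> (\<forall>F\<in>I. \<forall>G\<in>I. ge F G \<longrightarrow> C F \<subseteq> C G)"

definition quasi_central_family ::
  "'i set \<Rightarrow> ('i \<Rightarrow> 'i \<Rightarrow> bool) \<Rightarrow> ('i \<Rightarrow> 'a::semigroup_mult set) \<Rightarrow> 'a set \<Rightarrow> bool" where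
  "quasi_central_family I ge C A \<longleftrightarrow>
     downward_directed I ge C \<and>
     (\<forall>F\<in>I. C F \<subseteq> A) \<and>
     (\<forall>F\<in>I. \<forall>x\<in>C F. \<exists>G\<in>I. C G \<subseteq> left_quotient x (C F)) \<and>
     (\<forall>F\<in>I. piecewise_syndetic (C F))"

text \<open>
  HOL cannot quantify existentially over the type of the indices inside a definition, so the
  index set is drawn from the type \<^typ>\<open>'a set\<close>. This loses nothing: by
  \<open>quasi_centralI\<close> below, a family indexed by any type whatsoever is a witness.
\<close>

definition quasi_central :: "'a::semigroup_mult set \<Rightarrow> bool" where
  "quasi_central A \<longleftrightarrow>
     (\<exists>(I :: 'a set set) (ge :: 'a set \<Rightarrow> 'a set \<Rightarrow> bool) (C :: 'a set \<Rightarrow> 'a set).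
        quasi_central_family I ge C A)"

lemma quasi_centralI:
  fixes I :: "'i set" and C :: "'i \<Rightarrow> 'a::semigroup_mult set"
  assumes "quasi_central_family I ge C A"
  shows "quasi_central A"
proof -
  have dir: "\<exists>H\<in>I. C H \<subseteq> C F \<and> C H \<subseteq> C G" if "F \<in> I" "G \<in> I" for F G
    using assms that
    unfolding quasi_central_family_def downward_directed_def directed_set_def by meson
  have "directed_set (C ` I) (\<subseteq>)"
    using assms dir
    by (auto simp: quasi_central_family_def downward_directed_def directed_set_def
        intro!: reflp_onI transp_onI)
  then have "quasi_central_family (C ` I) (\<subseteq>) (\<lambda>B. B) A"
    using assms by (simp add: quasi_central_family_def downward_directed_def)
  then show ?thesis
    unfolding quasi_central_def by blast
qed

end

theory Submission
  imports Defs
begin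

lemma piecewise_syndetic_iff:
  "piecewise_syndetic B \<longleftrightarrow>
     (\<exists>G. finite G \<and> G \<noteq> {} \<and>
       (\<forall>F. finite F \<and> F \<noteq> {} \<longrightarrow> (\<exists>x. \<forall>f\<in>F. \<exists>t\<in>G. t * (f * x) \<in> B)))"
  by (simp add: piecewise_syndetic_def left_quotient_def image_subset_iff)

text \<open>
  If \<open>H\<close> and \<open>G\<close> witness piecewise syndeticity of the range and of \<open>B\<close>, then \<open>\<Phi>(G)H\<close> does so
  for \<open>\<Phi>(B)\<close>: first translate a finite set into the range up to \<open>H\<close>, then lift it to \<open>S\<close> and
  translate the lift into \<open>B\<close> up to \<open>G\<close>.
\<close>

lemma piecewise_syndetic_image:
  assumes hom: "semigroup_hom \<Phi>"
    and range: "piecewise_syndetic (range \<Phi>)"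
    and B: "piecewise_syndetic B"
  shows "piecewise_syndetic (\<Phi> ` B)"
proof -
  obtain H where "finite H" "H \<noteq> {}"
    and H: "\<forall>F. finite F \<and> F \<noteq> {} \<longrightarrow> (\<exists>y. \<forall>f\<in>F. \<exists>h\<in>H. h * (f * y) \<in> range \<Phi>)"
    using range unfolding piecewise_syndetic_iff by (elim exE conjE)
  obtain G where "finite G" "G \<noteq> {}"
    and G: "\<forall>F. finite F \<and> F \<noteq> {} \<longrightarrow> (\<exists>x. \<forall>f\<in>F. \<exists>g\<in>G. g * (f * x) \<in> B)"
    using B unfolding piecewise_syndetic_iff by (elim exE conjE)
  define K where "K = (\<lambda>(g, h). \<Phi> g * h) ` (G \<times> H)"
  have "\<exists>z. \<forall>f\<in>F. \<exists>k\<in>K. k * (f * z) \<in> \<Phi> ` B" if F: "finite F" "F \<noteq> {}" for F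
  proof -
    obtain y where "\<forall>f\<in>F. \<exists>h\<in>H. h * (f * y) \<in> range \<Phi>"
      using H[rule_format, of F] F by auto
    \<comment> \<open>Choosing a preimage \<open>s f\<close> for each \<open>f\<close> moves the
      problem from the codomain to the domain. The element \<open>h\<close> still varies with
      \<open>f\<close>.\<close>
    then have "\<forall>f\<in>F. \<exists>s. \<exists>h\<in>H. h * (f * y) = \<Phi> s"
      by blast
    then obtain s where s: "\<forall>f\<in>F. \<exists>h\<in>H. h * (f * y) = \<Phi> (s f)"
      by metis
    obtain x where x: "\<forall>f\<in>F. \<exists>g\<in>G. g * (s f * x) \<in> B"
      using G[rule_format, of "s ` F"] F by auto
    \<comment> \<open>The common translate is \<open>y * \<Phi> x\<close>: first \<open>y\<close>
      into the range, then the image of the translate found in the domain.\<close>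
    have "\<exists>k\<in>K. k * (f * (y * \<Phi> x)) \<in> \<Phi> ` B" if "f \<in> F" for f
    proof -
      obtain h where h: "h \<in> H" "h * (f * y) = \<Phi> (s f)"
        using s \<open>f \<in> F\<close> by blast
      obtain g where g: "g \<in> G" "g * (s f * x) \<in> B"
        using x \<open>f \<in> F\<close> by blast
      \<comment> \<open>Reassociating isolates \<open>h * (f * y)\<close>, which is
        \<open>\<Phi> (s f)\<close>; then every factor is an image under \<Phi>.\<close>
      have "\<Phi> g * h * (f * (y * \<Phi> x)) = \<Phi> g * (h * (f * y) * \<Phi> x)"
        by (simp add: mult.assoc)
      also have "\<dots> = \<Phi> (g * (s f * x))"
        using hom h(2) by (simp add: semigroup_hom_def)
      finally have "\<Phi> g * h * (f * (y * \<Phi> x)) \<in> \<Phi> ` B"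
        using g(2) by simp
      moreover have "\<Phi> g * h \<in> K"
        using g(1) h(1) by (auto simp: K_def)
      ultimately show ?thesis
        by blast
    qed
    then show ?thesis
      by blast
  qed
  moreover have "finite K" "K \<noteq> {}"
    using \<open>finite G\<close> \<open>finite H\<close> \<open>G \<noteq> {}\<close> \<open>H \<noteq> {}\<close> by (simp_all add: K_def)
  ultimately show ?thesis
    unfolding piecewise_syndetic_iff by (intro exI[of _ K]) simp
qed

text \<open>Multiplicativity of \<Phi> gives this inclusion, which carries the quotient condition of
  a quasi-central family over to images. Equality can fail, for instance when \<Phi> is not
  injective.\<close>

lemma image_left_quotient_subset:
  assumes "semigroup_hom \<Phi>"
  shows "\<Phi> ` left_quotient x B \<subseteq> left_quotient (\<Phi> x) (\<Phi> ` B)"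
proof
  fix z assume "z \<in> \<Phi> ` left_quotient x B"
  then obtain y where "x * y \<in> B" "z = \<Phi> y"
    unfolding left_quotient_def by blast
  moreover have "\<Phi> x * \<Phi> y = \<Phi> (x * y)"
    using assms unfolding semigroup_hom_def by simp
  ultimately show "z \<in> left_quotient (\<Phi> x) (\<Phi> ` B)"
    unfolding left_quotient_def by simp
qed

theorem theorem3p2:
  fixes \<Phi> :: "'s::semigroup_mult \<Rightarrow> 't::semigroup_mult" and A :: "'s set"
  assumes "semigroup_hom \<Phi>"
    and "piecewise_syndetic (range \<Phi>)"
    and "quasi_central A"
  shows "quasi_central (\<Phi> ` A)"
proof -
  obtain I :: "'s set set" and ge and C :: "'s set \<Rightarrow> 's set"
    where fam: "quasi_central_family I ge C A"
    using assms(3) unfolding quasi_central_def by blast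
  \<comment> \<open>The index \<open>G\<close> that works for any preimage of \<open>y\<close> in
    \<open>C F\<close> also works for \<open>y\<close>.\<close>
  have "\<exists>G\<in>I. \<Phi> ` C G \<subseteq> left_quotient y (\<Phi> ` C F)" if "F \<in> I" "y \<in> \<Phi> ` C F" for F y
  proof -
    obtain x where "x \<in> C F" "y = \<Phi> x"
      using \<open>y \<in> \<Phi> ` C F\<close> by blast
    moreover obtain G where "G \<in> I" "C G \<subseteq> left_quotient x (C F)"
      using fam \<open>F \<in> I\<close> \<open>x \<in> C F\<close> unfolding quasi_central_family_def by blast
    ultimately show ?thesis
      using image_left_quotient_subset[OF assms(1), of x "C F"] by blast
  qed
  moreover have "downward_directed I ge (\<lambda>F. \<Phi> ` C F)"
    using fam unfolding quasi_central_family_def downward_directed_def by (simp add: image_mono)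
  moreover have "\<Phi> ` C F \<subseteq> \<Phi> ` A" "piecewise_syndetic (\<Phi> ` C F)" if "F \<in> I" for F
    using fam that piecewise_syndetic_image[OF assms(1,2)]
    unfolding quasi_central_family_def by (simp_all add: image_mono)
  ultimately have "quasi_central_family I ge (\<lambda>F. \<Phi> ` C F) (\<Phi> ` A)"
    unfolding quasi_central_family_def by blast
  then show ?thesis
    \<comment> \<open>The image family is still indexed by subsets of the domain, so it has to be
      reindexed to fit the definition in the codomain.\<close>
    by (rule quasi_centralI)
qed

end
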